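(* Let $s$ be the maximal real solution, defined on the open interval $I \subseteq \mathbb{R}$ containing $0$, of the initial value problem $\ddot{s}(t) = 6 s(t)^2 + 6t$, $s(0) = \dot{s}(0) = 0$, and let $t_\infty$ be its (finite, positive) blow-up time. Then $$t_{\infty} > \sqrt{\frac{3}{2}} \arctan \sqrt{\frac{2}{3}} + \frac{2}{3} \log \frac{5}{2}.$$
   Context: Dots denote derivatives with respect to the real variable $t$. The interval $I$ is the maximal open interval about $0$ on which the (unique) real solution $s$ of the initial value problem exists. The blow-up time $t_\infty > 0$ is the finite real number with $I \cap [0,\infty) = [0, t_\infty)$; it satisfies $s(t) \to \infty$ as $t \uparrow t_\infty$. Here $\log$ is the natural logarithm. *)

theory Defs
  imports "HOL-Analysis.Analysis"
begin

(* As J is open, the condition depends only on the values of s on J;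
   s is total, but its values outside J are irrelevant. J may be unbounded. *)
definition solves_ivp_on :: "(real \<Rightarrow> real) \<Rightarrow> real set \<Rightarrow> bool" where
  "solves_ivp_on s J \<longleftrightarrow>
     open J \<and> is_interval J \<and> 0 \<in> J \<and>
     (\<forall>t\<in>J. (s has_real_derivative deriv s t) (at t)) \<and>
     (\<forall>t\<in>J. (deriv s has_real_derivative 6 * (s t)\<^sup>2 + 6 * t) (at t)) \<and>
     s 0 = 0 \<and> deriv s 0 = 0"

definition maximal_ivp_solution :: "(real \<Rightarrow> real) \<Rightarrow> real set \<Rightarrow> bool" where
  "maximal_ivp_solution s I \<longleftrightarrow>
     solves_ivp_on s I \<and>
     (\<forall>r J. solves_ivp_on r J \<longrightarrow> I \<subseteq> J \<longrightarrow> (\<forall>t\<in>I. r t = s t) \<longrightarrow> J = I)"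

definition is_blowup_time :: "real set \<Rightarrow> real \<Rightarrow> bool" where
  "is_blowup_time I T \<longleftrightarrow> 0 < T \<and> I \<inter> {0..} = {0..<T}"

end

theory Submission
  imports Defs
begin

text \<open>
  Put \<open>c = 31/20\<close>, which already exceeds the claimed bound. The function
  \<open>1 / (c - t)\<^sup>2 - 41/100\<close> is a strict supersolution of the differential equation on \<open>[0, c)\<close>,
  so it dominates \<open>s\<close> there, and its derivative dominates \<open>s'\<close>. If \<open>t\<^sub>\<infinity> < c\<close> then \<open>s\<close> and \<open>s'\<close>,
  being nondecreasing and bounded on \<open>[0, t\<^sub>\<infinity>)\<close>, have limits at \<open>t\<^sub>\<infinity>\<close>, and the power series
  solution with these limits as initial data extends \<open>s\<close> beyond \<open>t\<^sub>\<infinity>\<close>, against maximality.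
\<close>

section \<open>Local power series solutions\<close>

text \<open>These are the Taylor coefficients at \<open>T\<close> of the solution with value
  \<open>a\<close> and slope \<open>b\<close> there, found by comparing coefficients of
  \<open>(t - T) ^ n\<close> in the equation. The special cases \<open>n = 0\<close> and
  \<open>n = 1\<close> come from \<open>6 * t = 6 * T + 6 * (t - T)\<close>.\<close>

fun painleve_coeff :: "real \<Rightarrow> real \<Rightarrow> real \<Rightarrow> nat \<Rightarrow> real" where
  "painleve_coeff T a b 0 = a"
| "painleve_coeff T a b (Suc 0) = b"
| "painleve_coeff T a b (Suc (Suc n)) =
     (6 * (\<Sum>k\<in>{0..n}. painleve_coeff T a b k * painleve_coeff T a b (n - k))
        + (if n = 0 then 6 * T else 0) + (if n = 1 then 6 else 0)) / (real (n + 2) * real (n + 1))"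

text \<open>Strong induction: the convolution has \<open>m + 1\<close> terms, each at most
  \<open>A * A * M ^ m\<close>, and the denominator absorbs the factor \<open>m + 1\<close>. The
  choice of \<open>M\<close> turns the total factor \<open>6 * (A + \<bar>T\<bar> + 1)\<close> into
  \<open>2 * M\<close>, which is at most \<open>(m + 2) * M^2\<close>.\<close>

lemma painleve_coeff_bound:
  fixes T a b :: real
  defines "A \<equiv> 1 + \<bar>a\<bar> + \<bar>b\<bar>"
  defines "M \<equiv> 3 * (A + \<bar>T\<bar> + 1)"
  shows "\<bar>painleve_coeff T a b n\<bar> \<le> A * M ^ n"
proof (induction n rule: less_induct)
  case (less n)
  have A: "A \<ge> 1" and M: "M \<ge> 1" by (auto simp: A_def M_def)
  consider "n = 0" | "n = 1" | m where "n = Suc (Suc m)"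
    by (metis One_nat_def old.nat.exhaust)
  then show ?case
  proof cases
    case 1
    then show ?thesis by (simp add: A_def)
  next
    case 2
    have "A * 1 \<le> A * M" using A M by (intro mult_left_mono) auto
    then show ?thesis using 2 by (simp add: A_def)
  next
    case (3 m)
    let ?c = "painleve_coeff T a b"
    have Mm: "1 \<le> M ^ m" using M by simp
    have "\<bar>\<Sum>k\<in>{0..m}. ?c k * ?c (m - k)\<bar> \<le> (\<Sum>k\<in>{0..m}. A * A * M ^ m)"
    proof (rule order_trans[OF sum_abs sum_mono])
      fix k assume k: "k \<in> {0..m}"
      have "\<bar>?c k * ?c (m - k)\<bar> \<le> (A * M ^ k) * (A * M ^ (m - k))"
        unfolding abs_mult using k 3 A M by (intro mult_mono less) auto
      also have "\<dots> = A * A * (M ^ k * M ^ (m - k))" by (simp add: algebra_simps)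
      also have "M ^ k * M ^ (m - k) = M ^ m" using k by (simp flip: power_add)
      finally show "\<bar>?c k * ?c (m - k)\<bar> \<le> A * A * M ^ m" .
    qed
    then have sum_le: "\<bar>\<Sum>k\<in>{0..m}. ?c k * ?c (m - k)\<bar> \<le> real (m + 1) * (A * A * M ^ m)"
      by simp
    \<comment> \<open>The inhomogeneous term is inflated by a factor that is at least 1, so that it
      takes the shape of the convolution bound and the two can be added.\<close>
    have "\<bar>(if m = 0 then 6 * T else 0) + (if m = 1 then 6 else (0::real))\<bar> \<le> 6 * (\<bar>T\<bar> + 1) * 1"
      by auto
    also have "\<dots> \<le> 6 * (\<bar>T\<bar> + 1) * (A * M ^ m * real (m + 1))"
    proof (intro mult_left_mono)
      have "1 * 1 * 1 \<le> A * M ^ m * real (m + 1)"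
        using A Mm by (intro mult_mono) auto
      then show "1 \<le> A * M ^ m * real (m + 1)" by simp
    qed auto
    finally have "\<bar>6 * (\<Sum>k\<in>{0..m}. ?c k * ?c (m - k))
        + (if m = 0 then 6 * T else 0) + (if m = 1 then 6 else 0)\<bar>
        \<le> 6 * (real (m + 1) * (A * A * M ^ m)) + 6 * (\<bar>T\<bar> + 1) * (A * M ^ m * real (m + 1))"
      using sum_le by linarith
    also have "\<dots> = real (m + 1) * A * M ^ m * (2 * M)"
      by (simp add: M_def algebra_simps)
    also have "\<dots> \<le> real (m + 1) * A * M ^ m * (real (m + 2) * M\<^sup>2)"
      using A M by (intro mult_left_mono mult_mono) (auto simp: self_le_power)
    also have "\<dots> = A * M ^ n * (real (m + 2) * real (m + 1))"
      by (simp add: 3 power2_eq_square algebra_simps)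
    finally show ?thesis
      by (simp add: 3 abs_divide pos_divide_le_eq abs_mult del: of_nat_add of_nat_Suc)
  qed
qed

text \<open>The geometric coefficient bound gives a positive radius of convergence. The recurrence
  is the equation for formal power series, and evaluation inside the disc of convergence carries it
  over to functions.\<close>

lemma painleve_local_solution:
  fixes T a b :: real
  obtains p p' :: "real \<Rightarrow> real" and \<delta> :: real where
    "\<delta> > 0" "p T = a" "p' T = b"
    "\<And>t. \<bar>t - T\<bar> < \<delta> \<Longrightarrow> (p has_real_derivative p' t) (at t)"
    "\<And>t. \<bar>t - T\<bar> < \<delta> \<Longrightarrow> (p' has_real_derivative 6 * (p t)\<^sup>2 + 6 * t) (at t)"
proof -
  define A where "A = 1 + \<bar>a\<bar> + \<bar>b\<bar>"
  define M where "M = 3 * (A + \<bar>T\<bar> + 1)"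
  define F where "F = Abs_fps (painleve_coeff T a b)"
  \<comment> \<open>With this radius \<open>M * \<delta> = 1/2\<close>, so the series at
    \<open>\<delta>\<close> is dominated by a geometric one.\<close>
  define \<delta> where "\<delta> = 1 / (2 * M)"
  have M: "M > 0" by (simp add: M_def A_def add_pos_nonneg)
  then have \<delta>: "\<delta> > 0" by (simp add: \<delta>_def)
  have "summable (\<lambda>n. fps_nth F n * \<delta> ^ n)"
  proof (rule summable_comparison_test')
    show "summable (\<lambda>n. A * (1/2) ^ n :: real)" by (intro summable_mult summable_geometric) auto
    show "norm (fps_nth F n * \<delta> ^ n) \<le> A * (1/2) ^ n" for n
    proof -
      have "norm (fps_nth F n * \<delta> ^ n) \<le> (A * M ^ n) * \<delta> ^ n"
        using painleve_coeff_bound[of T a b n] \<delta>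
        by (auto simp: abs_mult F_def A_def M_def intro!: mult_right_mono)
      also have "\<dots> = A * (M * \<delta>) ^ n" by (simp add: power_mult_distrib)
      also have "M * \<delta> = 1/2" using M by (simp add: \<delta>_def)
      finally show ?thesis .
    qed
  qed
  from conv_radius_geI[OF this] have r: "fps_conv_radius F \<ge> ereal \<delta>"
    using \<delta> by (simp add: fps_conv_radius_def)
  have r': "fps_conv_radius (fps_deriv F) \<ge> ereal \<delta>"
    using order_trans[OF r fps_conv_radius_deriv] .
  \<comment> \<open>The formal variable stands for \<open>t - T\<close>, so the last bracket
    represents \<open>6 * t\<close>.\<close>
  have ode: "fps_deriv (fps_deriv F) = fps_const 6 * (F * F) + (fps_const (6 * T) + fps_const 6 * fps_X)"
  proof (rule fps_ext)
    fix n
    have "fps_nth (F * F) n = (\<Sum>k\<in>{0..n}. painleve_coeff T a b k * painleve_coeff T a b (n - k))"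
      by (simp add: fps_mult_nth F_def)
    then have "real (n + 1) * real (n + 2) * painleve_coeff T a b (n + 2) =
        6 * fps_nth (F * F) n + (if n = 0 then 6 * T else 0) + (if n = 1 then 6 else 0)"
      by (simp del: of_nat_Suc of_nat_add)
    then show "fps_nth (fps_deriv (fps_deriv F)) n =
        fps_nth (fps_const 6 * (F * F) + (fps_const (6 * T) + fps_const 6 * fps_X)) n"
      by (simp add: F_def fps_eq_iff mult.assoc del: of_nat_Suc of_nat_add painleve_coeff.simps)
  qed
  define p where "p t = eval_fps F (t - T)" for t
  define p' where "p' t = eval_fps (fps_deriv F) (t - T)" for t
  show ?thesis
  proof (rule that[OF \<delta>])
    show "p T = a" "p' T = b"
      by (simp_all add: p_def p'_def eval_fps_at_0 F_def)
  next
    fix t assume t: "\<bar>t - T\<bar> < \<delta>"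
    have inF: "ereal (norm (t - T)) < fps_conv_radius F"
      and inF': "ereal (norm (t - T)) < fps_conv_radius (fps_deriv F)"
      using t r r' by (auto intro: less_le_trans[of _ "ereal \<delta>"])
    have "((\<lambda>t. eval_fps F (t - T)) has_real_derivative eval_fps (fps_deriv F) (t - T) * 1) (at t)"
      by (rule DERIV_chain'[where g = "eval_fps F"])
         (use inF in \<open>auto intro!: derivative_eq_intros has_field_derivative_eval_fps\<close>)
    then show "(p has_real_derivative p' t) (at t)"
      by (simp add: p_def[abs_def] p'_def)
    have eq: "eval_fps (fps_deriv (fps_deriv F)) (t - T) = 6 * (p t)\<^sup>2 + 6 * t"
    proof -
      have FF: "ereal (norm (t - T)) < fps_conv_radius (F * F)"
        using inF fps_conv_radius_mult[of F F] by auto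
      have C: "ereal (norm (t - T)) < fps_conv_radius (fps_const 6 * (F * F))"
        using FF fps_conv_radius_mult[of "fps_const 6" "F * F"] by auto
      have X: "fps_conv_radius (fps_const 6 * fps_X :: real fps) = \<infinity>"
        using fps_conv_radius_mult[of "fps_const 6" "fps_X :: real fps"] by simp
      have X': "fps_conv_radius (fps_const (6 * T) + fps_const 6 * fps_X :: real fps) = \<infinity>"
        using fps_conv_radius_add[of "fps_const (6 * T)" "fps_const 6 * fps_X :: real fps"] X by simp
      show ?thesis
        unfolding ode using inF FF C X X'
        by (simp add: eval_fps_add eval_fps_mult p_def power2_eq_square)
    qed
    have "((\<lambda>t. eval_fps (fps_deriv F) (t - T)) has_real_derivative
        eval_fps (fps_deriv (fps_deriv F)) (t - T) * 1) (at t)"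
      by (rule DERIV_chain'[where g = "eval_fps (fps_deriv F)"])
         (use inF' in \<open>auto intro!: derivative_eq_intros has_field_derivative_eval_fps\<close>)
    then show "(p' has_real_derivative 6 * (p t)\<^sup>2 + 6 * t) (at t)"
      by (simp add: eq p'_def[abs_def])
  qed
qed

section \<open>Continuation of solutions\<close>

text \<open>L'Hopital's rule applied to the difference quotient at \<open>x\<close>. This handles
  the seam of two glued solutions, where the derivative is known only on a punctured
  neighbourhood.\<close>

lemma DERIV_at_removable:
  fixes f f' :: "real \<Rightarrow> real"
  assumes "isCont f x" "isCont f' x"
    and "\<forall>\<^sub>F y in at x. (f has_real_derivative f' y) (at y)"
  shows "(f has_real_derivative f' x) (at x)"
proof -
  have "((\<lambda>y. (f y - f x) / (y - x)) \<longlongrightarrow> f' x) (at x)"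
  proof (rule lhopital[where f' = f' and g' = "\<lambda>_. 1"])
    show "((\<lambda>y. f y - f x) \<longlongrightarrow> 0) (at x)"
      using assms(1) by (simp add: isCont_def LIM_zero)
    show "((\<lambda>y. y - x) \<longlongrightarrow> 0) (at x)"
      by (intro tendsto_eq_intros) auto
    show "\<forall>\<^sub>F y in at x. y - x \<noteq> 0" by (simp add: eventually_at_filter)
    show "\<forall>\<^sub>F y in at x. (1::real) \<noteq> 0" by simp
    show "\<forall>\<^sub>F y in at x. ((\<lambda>y. f y - f x) has_real_derivative f' y) (at y)"
      using assms(3) by eventually_elim (auto intro!: derivative_eq_intros)
    show "\<forall>\<^sub>F y in at x. ((\<lambda>y. y - x) has_real_derivative 1) (at y)"
      by (intro always_eventually allI) (auto intro!: derivative_eq_intros)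
    show "((\<lambda>y. f' y / 1) \<longlongrightarrow> f' x) (at x)"
      using assms(2) by (simp add: isCont_def)
  qed
  then show ?thesis by (simp add: has_field_derivative_iff)
qed

lemma isCont_glue:
  fixes f g :: "real \<Rightarrow> real"
  assumes "(f \<longlongrightarrow> g T) (at_left T)" "isCont g T"
  shows "isCont (\<lambda>t. if t < T then f t else g t) T"
proof -
  have "((\<lambda>t. if t < T then f t else g t) \<longlongrightarrow> g T) (at_left T)"
    using assms(1) by (rule Lim_transform_eventually) (auto simp: eventually_at_filter)
  moreover have "((\<lambda>t. if t < T then f t else g t) \<longlongrightarrow> g T) (at_right T)"
  proof (rule Lim_transform_eventually)
    show "(g \<longlongrightarrow> g T) (at_right T)"
      using assms(2) by (auto simp: isCont_def filterlim_at_split)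
  qed (auto simp: eventually_at_filter)
  ultimately show ?thesis by (simp add: isCont_def filterlim_at_split)
qed

text \<open>Away from \<open>T\<close> the glued function coincides locally with one piece. At
  \<open>T\<close> it is continuous and so is the glued derivative, so the singularity of the
  derivative is removable.\<close>

lemma DERIV_glue:
  fixes f g f' g' :: "real \<Rightarrow> real"
  assumes f: "\<And>u. u \<in> J \<Longrightarrow> u < T \<Longrightarrow> (f has_real_derivative f' u) (at u)"
    and g: "\<And>u. u \<in> J \<Longrightarrow> T \<le> u \<Longrightarrow> (g has_real_derivative g' u) (at u)"
    and "(f \<longlongrightarrow> g T) (at_left T)"
    and "isCont (\<lambda>t. if t < T then f' t else g' t) T"
    and "open J" "t \<in> J"
  shows "((\<lambda>t. if t < T then f t else g t) has_real_derivative (if t < T then f' t else g' t)) (at t)"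
proof -
  let ?h = "\<lambda>t. if t < T then f t else g t" and ?h' = "\<lambda>t. if t < T then f' t else g' t"
  have ne: "(?h has_real_derivative ?h' u) (at u)" if "u \<in> J" "u \<noteq> T" for u
  proof (cases "u < T")
    case True
    have "(?h has_real_derivative f' u) (at u)"
      by (rule has_field_derivative_transform_within_open[OF f[OF that(1) True], of "{..<T}"])
         (use True in auto)
    then show ?thesis using True by simp
  next
    case False
    have "(?h has_real_derivative g' u) (at u)"
      by (rule has_field_derivative_transform_within_open[OF g[OF that(1)], of "{T<..}"])
         (use False that in auto)
    then show ?thesis using False by simp
  qed
  show ?thesis
  proof (cases "t = T")
    case True
    have "isCont g T"
      using g[of T] True assms(6) by (auto intro: DERIV_isCont)
    with assms(3) have "isCont ?h T" by (rule isCont_glue)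
    moreover have "\<forall>\<^sub>F u in at T. (?h has_real_derivative ?h' u) (at u)"
      unfolding eventually_at_filter
    proof (rule eventually_mono[OF eventually_nhds_in_open[OF assms(5)]])
      show "T \<in> J" using True assms(6) by simp
      show "u \<noteq> T \<longrightarrow> u \<in> UNIV \<longrightarrow> (?h has_real_derivative ?h' u) (at u)" if "u \<in> J" for u
        using ne[OF that] by blast
    qed
    ultimately show ?thesis using DERIV_at_removable[where f = ?h and x = T and f' = ?h'] assms(4) True by blast
  qed (use ne assms(6) in blast)
qed

text \<open>The power series solution with data \<open>a\<close>, \<open>b\<close> at
  \<open>T\<close> is glued to \<open>s\<close>. Values and slopes match by the choice of data,
  second derivatives by the equation itself, so the result is a proper extension.\<close>

lemma finite_limits_imp_not_maximal:
  fixes s :: "real \<Rightarrow> real"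
  assumes sol: "solves_ivp_on s I" and T: "is_blowup_time I T"
    and lim: "(s \<longlongrightarrow> a) (at_left T)" "(deriv s \<longlongrightarrow> b) (at_left T)"
  shows "\<not> maximal_ivp_solution s I"
proof
  assume max: "maximal_ivp_solution s I"
  obtain p p' \<delta> where \<delta>: "\<delta> > 0" and p: "p T = a" "p' T = b"
    "\<And>t. \<bar>t - T\<bar> < \<delta> \<Longrightarrow> (p has_real_derivative p' t) (at t)"
    "\<And>t. \<bar>t - T\<bar> < \<delta> \<Longrightarrow> (p' has_real_derivative 6 * (p t)\<^sup>2 + 6 * t) (at t)"
    using painleve_local_solution[of T a b] by blast
  have T0: "0 < T" and IT: "I \<inter> {0..} = {0..<T}"
    using T by (auto simp: is_blowup_time_def)
  have I_less: "t < T" if "t \<in> I" for t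
    using that IT T0 by (cases "0 \<le> t") auto
  have I0T: "{0<..<T} \<subseteq> I"
  proof
    fix t assume "t \<in> {0<..<T}"
    then have "t \<in> I \<inter> {0..}" unfolding IT by simp
    then show "t \<in> I" by simp
  qed
  \<comment> \<open>Starting the added interval at 0 makes it meet \<open>I\<close>, at
    \<open>T / 2\<close>, so the union is connected. Its only new points lie in
    \<open>[T, T + \<delta>)\<close>, where \<open>p\<close> solves the equation.\<close>
  define J where "J = I \<union> {0<..<T + \<delta>}"
  define r where "r t = (if t < T then s t else p t)" for t
  define v where "v t = (if t < T then deriv s t else p' t)" for t
  have oJ: "open J" using sol by (auto simp: J_def solves_ivp_on_def)
  have J_I: "t \<in> I" if "t \<in> J" "t < T" for t
    using that I0T by (auto simp: J_def)
  have J_p: "\<bar>t - T\<bar> < \<delta>" if "t \<in> J" "T \<le> t" for t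
    using that I_less[of t] by (auto simp: J_def)
  have "T / 2 \<in> I \<inter> {0<..<T + \<delta>}" using I0T T0 \<delta> by auto
  then have iJ: "is_interval J"
    unfolding J_def is_interval_connected_1 using sol
    by (intro connected_Un) (auto simp: solves_ivp_on_def is_interval_connected_1)
  have contr: "isCont r T"
    unfolding r_def using lim(1) p(1) DERIV_isCont[OF p(3)[of T]] \<delta> by (intro isCont_glue) auto
  have contv: "isCont v T"
    unfolding v_def using lim(2) p(2) DERIV_isCont[OF p(4)[of T]] \<delta> by (intro isCont_glue) auto
  have dr: "(r has_real_derivative v t) (at t)" if "t \<in> J" for t
    unfolding r_def[abs_def] v_def
  proof (rule DERIV_glue[OF _ _ _ _ oJ that])
    show "isCont (\<lambda>t. if t < T then deriv s t else p' t) T"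
      using contv by (simp add: v_def[abs_def])
  qed (use sol J_I J_p p lim in \<open>auto simp: solves_ivp_on_def\<close>)
  \<comment> \<open>The right-hand side along \<open>r\<close> is written as a glued function, whose
    continuity at \<open>T\<close> then follows from that of \<open>r\<close>.\<close>
  have rhs: "6 * (r t)\<^sup>2 + 6 * t =
      (if t < T then 6 * (s t)\<^sup>2 + 6 * t else 6 * (p t)\<^sup>2 + 6 * t)" for t
    by (simp add: r_def)
  have dv: "(v has_real_derivative 6 * (r t)\<^sup>2 + 6 * t) (at t)" if "t \<in> J" for t
    unfolding rhs v_def[abs_def]
  proof (rule DERIV_glue[OF _ _ _ _ oJ that])
    have "isCont (\<lambda>t. 6 * (r t)\<^sup>2 + 6 * t) T" using contr by (intro continuous_intros)
    then show "isCont (\<lambda>t. if t < T then 6 * (s t)\<^sup>2 + 6 * t else 6 * (p t)\<^sup>2 + 6 * t) T"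
      unfolding rhs .
  qed (use sol J_I J_p p lim in \<open>auto simp: solves_ivp_on_def\<close>)
  have deriv_r: "deriv r t = v t" if "t \<in> J" for t
    using dr[OF that] by (rule DERIV_imp_deriv)
  have "(deriv r has_real_derivative 6 * (r t)\<^sup>2 + 6 * t) (at t)" if "t \<in> J" for t
    by (rule has_field_derivative_transform_within_open[OF dv[OF that] oJ that])
       (simp add: deriv_r)
  moreover have "0 \<in> J" using sol by (simp add: J_def solves_ivp_on_def)
  ultimately have "solves_ivp_on r J"
    using oJ iJ dr deriv_r T0 sol by (auto simp: solves_ivp_on_def r_def v_def)
  moreover have "I \<subseteq> J" "\<forall>t\<in>I. r t = s t" using I_less by (auto simp: J_def r_def)
  ultimately have "J = I" using max by (auto simp: maximal_ivp_solution_def)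
  moreover have "T \<in> J" using T0 \<delta> by (simp add: J_def)
  ultimately show False using I_less by blast
qed

lemma mono_bounded_tendsto_at_left:
  fixes f :: "real \<Rightarrow> real"
  assumes "a < T"
    and "\<And>x y. a \<le> x \<Longrightarrow> x \<le> y \<Longrightarrow> y < T \<Longrightarrow> f x \<le> f y"
    and "\<And>x. a \<le> x \<Longrightarrow> x < T \<Longrightarrow> f x \<le> K"
  obtains L where "(f \<longlongrightarrow> L) (at_left T)"
proof -
  \<comment> \<open>Near \<open>T\<close> the cut at \<open>a\<close> is invisible, so the one-sided
    limit may be taken over \<open>[a, T)\<close>, where monotonicity and the bound are
    available.\<close>
  have "at T within ({..<T} \<inter> {a..}) = at_left T"
    by (rule at_within_nhd[of _ "{a<..}"]) (use assms(1) in auto)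
  moreover have "(f \<longlongrightarrow> Sup (f ` ({..<T} \<inter> {a..}))) (at T within ({..<T} \<inter> {a..}))"
    by (rule Lim_left_bound[where K = K]) (use assms in auto)
  ultimately show ?thesis using that by simp
qed

section \<open>Comparison with a supersolution\<close>

lemma DERIV_nonneg_imp_mono_Ico:
  fixes f f' :: "real \<Rightarrow> real"
  assumes "\<And>t. 0 \<le> t \<Longrightarrow> t < T \<Longrightarrow> (f has_real_derivative f' t) (at t)"
    and "\<And>t. 0 \<le> t \<Longrightarrow> t < T \<Longrightarrow> f' t \<ge> 0"
    and "0 \<le> x" "x \<le> y" "y < T"
  shows "f x \<le> f y"
  using assms(4)
proof (rule DERIV_nonneg_imp_nondecreasing)
  fix z assume "x \<le> z" "z \<le> y"
  then have "0 \<le> z" "z < T" using assms(3,5) by auto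
  then show "\<exists>D. (f has_real_derivative D) (at z) \<and> 0 \<le> D" using assms(1,2) by blast
qed

text \<open>A continuation argument: while \<open>d\<close> is positive, \<open>d'\<close> is
  nondecreasing and hence nonnegative, so \<open>d\<close> stays at least \<open>d 0\<close> and
  cannot reach a first zero.\<close>

lemma second_order_positive:
  fixes d d' d'' :: "real \<Rightarrow> real"
  assumes d: "\<And>t. 0 \<le> t \<Longrightarrow> t < T \<Longrightarrow> (d has_real_derivative d' t) (at t)"
    and d': "\<And>t. 0 \<le> t \<Longrightarrow> t < T \<Longrightarrow> (d' has_real_derivative d'' t) (at t)"
    and init: "d 0 > 0" "d' 0 \<ge> 0"
    and convex: "\<And>t. 0 \<le> t \<Longrightarrow> t < T \<Longrightarrow> d t > 0 \<Longrightarrow> d'' t \<ge> 0"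
    and t: "0 \<le> t" "t < T"
  shows "d t > 0 \<and> d' t \<ge> 0"
proof -
  \<comment> \<open>Positivity is required only strictly before \<open>x\<close>, so that this still
    applies at the first point where \<open>d\<close> fails to be positive.\<close>
  have mono: "d' x \<ge> 0"
    if "0 \<le> x" "x < T" and d_pos: "\<And>u. 0 \<le> u \<Longrightarrow> u < x \<Longrightarrow> d u > 0" for x
  proof -
    have "d' 0 \<le> d' x"
    proof (rule DERIV_nonneg_imp_increasing_open[OF that(1)])
      show "\<exists>y. (d' has_real_derivative y) (at u) \<and> 0 \<le> y" if "0 < u" "u < x" for u
      proof -
        have "0 \<le> u" "u < T" using that \<open>x < T\<close> by auto
        moreover have "d u > 0" using d_pos[of u] that by simp
        ultimately show ?thesis using d' convex by blast
      qed
      show "continuous_on {0..x} d'"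
        by (intro continuous_at_imp_continuous_on ballI DERIV_isCont[OF d'])
           (use \<open>x < T\<close> in auto)
    qed
    with init show ?thesis by simp
  qed
  have pos: "d x > 0" if "0 \<le> x" "x < T" for x
  proof (rule ccontr)
    assume "\<not> d x > 0"
    \<comment> \<open>\<open>Inf C\<close> is the first point of failure; it belongs to
      \<open>C\<close> because \<open>C\<close> is closed.\<close>
    define C where "C = {u \<in> {0..x}. d u \<le> 0}"
    have "continuous_on {0..x} d"
      by (intro continuous_at_imp_continuous_on ballI DERIV_isCont[OF d]) (use \<open>x < T\<close> in auto)
    then have "closed ({0..x} \<inter> d -` {..0})"
      by (intro continuous_closed_preimage) auto
    moreover have "C = {0..x} \<inter> d -` {..0}" by (auto simp: C_def)
    ultimately have "closed C" by simp
    moreover have ne: "C \<noteq> {}" using \<open>\<not> d x > 0\<close> that by (auto simp: C_def)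
    moreover have bdd: "bdd_below C" by (auto simp: C_def intro!: bdd_belowI[of _ 0])
    ultimately have "Inf C \<in> C" by (intro closed_contains_Inf)
    then have \<tau>: "0 \<le> Inf C" "Inf C \<le> x" "d (Inf C) \<le> 0" by (auto simp: C_def)
    have before: "d u > 0" if "0 \<le> u" "u < Inf C" for u
    proof (rule ccontr)
      assume "\<not> d u > 0"
      then have "u \<in> C" using that \<tau>(2) by (simp add: C_def)
      from cInf_lower[OF this bdd] that show False by simp
    qed
    have "d 0 \<le> d (Inf C)"
    proof (rule DERIV_nonneg_imp_nondecreasing[OF \<tau>(1)])
      fix u assume u: "0 \<le> u" "u \<le> Inf C"
      have "d' u \<ge> 0" by (rule mono) (use u \<tau>(2) \<open>x < T\<close> before in auto)
      then show "\<exists>y. (d has_real_derivative y) (at u) \<and> 0 \<le> y"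
        using d[of u] u \<tau>(2) \<open>x < T\<close> by (meson order_trans le_less_trans)
    qed
    with \<tau> init show False by simp
  qed
  show ?thesis using pos[OF t] mono[OF t] pos t(2) by (meson less_trans)
qed

text \<open>
  With \<open>w = 31/20 - t\<close>, a function \<open>1 / w\<^sup>2 - B\<close> is a supersolution as soon as
  \<open>w\<^sup>2 (B\<^sup>2 + 31/20 - w) \<le> 2 B\<close>; the cubic on the left is largest at \<open>w = 2/3 (B\<^sup>2 + 31/20)\<close>, near
  \<open>23/20\<close>, and \<open>B\<close> is chosen just below the value \<open>1 / (31/20)\<^sup>2\<close> that makes the function
  vanish at \<open>t = 0\<close>.
\<close>
lemma supersolution_ineq:
  fixes w :: real
  assumes "0 < w"
  shows "6 * (1 / w\<^sup>2 - 41/100)\<^sup>2 + 6 * (31/20 - w) \<le> 6 / w ^ 4"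
proof -
  \<comment> \<open>The double root sits near the maximiser of the cubic, and the cofactor
    \<open>w + 23/40\<close> cancels the linear term. What remains below is a quadratic without
    linear term and with positive coefficients.\<close>
  have cubic: "0 \<le> (w - 23/20)\<^sup>2 * (w + 23/40)" using assms by simp
  then have "w\<^sup>2 * ((41/100)\<^sup>2 + (31/20 - w)) \<le> 41/50"
  proof -
    have "41/50 - w\<^sup>2 * ((41/100)\<^sup>2 + (31/20 - w))
        = (w - 23/20)\<^sup>2 * (w + 23/40) + 69/10000 * w\<^sup>2 + 953/16000"
      by algebra
    with cubic show ?thesis
      using zero_le_power2[of w] by linarith
  qed
  then have "(41/100)\<^sup>2 + (31/20 - w) \<le> 41/50 / w\<^sup>2"
    using assms by (simp add: field_simps)
  moreover have "(1 / w\<^sup>2 - 41/100)\<^sup>2 = 1 / w ^ 4 - 41/50 / w\<^sup>2 + (41/100)\<^sup>2"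
    using assms by (simp add: power2_diff power_divide)
  ultimately show ?thesis by simp
qed

lemma DERIV_divide_power_diff:
  fixes a c x :: real
  assumes "c \<noteq> x"
  shows "((\<lambda>x. a / (c - x) ^ n) has_real_derivative a * real n / (c - x) ^ Suc n) (at x)"
proof (cases n)
  case (Suc m)
  have "((\<lambda>x. a / (c - x) ^ n) has_real_derivative
      (a * (real n * (c - x) ^ m)) / ((c - x) ^ n * (c - x) ^ n)) (at x)"
    by (rule derivative_eq_intros refl)+ (use assms Suc in auto)
  moreover have "(a * (real n * (c - x) ^ m)) / ((c - x) ^ n * (c - x) ^ n)
      = a * real n / (c - x) ^ Suc n"
  proof -
    define w where "w = c - x"
    have "w \<noteq> 0" using assms by (simp add: w_def)
    then have "(a * (real n * w ^ m)) / (w ^ n * w ^ n) = a * real n / w ^ Suc n"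
      by (simp add: Suc field_simps)
    then show ?thesis by (simp add: w_def)
  qed
  ultimately show ?thesis by simp
qed simp

text \<open>The gap \<open>d\<close> between supersolution and solution satisfies the hypotheses of
  \<open>second_order_positive\<close>: \<open>d 0 = 400/961 - 41/100\<close> is just positive, and
  \<open>d'' \<ge> 0\<close> wherever \<open>d > 0\<close>. The bound on \<open>s\<close> drops the
  constant \<open>41/100\<close>.\<close>

lemma solution_bounds:
  fixes s :: "real \<Rightarrow> real"
  assumes sol: "solves_ivp_on s I" and sub: "{0..<T} \<subseteq> I" and T: "T < 31/20" and t: "0 \<le> t" "t < T"
  shows "0 \<le> deriv s t" "s t \<le> 1 / (31/20 - t)\<^sup>2" "deriv s t \<le> 2 / (31/20 - t) ^ 3"
proof -
  have ds: "(s has_real_derivative deriv s u) (at u)"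
    and dds: "(deriv s has_real_derivative 6 * (s u)\<^sup>2 + 6 * u) (at u)"
    if "0 \<le> u" "u < T" for u
    using sol sub that by (auto simp: solves_ivp_on_def)
  have init: "s 0 = 0" "deriv s 0 = 0" using sol by (auto simp: solves_ivp_on_def)
  have s': "0 \<le> deriv s u" if "0 \<le> u" "u < T" for u
    using DERIV_nonneg_imp_mono_Ico[OF dds, of T 0 u] that init by simp
  then show "0 \<le> deriv s t" using t by simp
  \<comment> \<open>Nonnegativity of \<open>s\<close> lets the comparison with the supersolution
    survive squaring.\<close>
  have s: "0 \<le> s u" if "0 \<le> u" "u < T" for u
    using DERIV_nonneg_imp_mono_Ico[OF ds s', of T 0 u] that init by simp
  define d where "d u = 1 / (31/20 - u)\<^sup>2 - 41/100 - s u" for u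
  define d' where "d' u = 2 / (31/20 - u) ^ 3 - deriv s u" for u
  define d'' where "d'' u = 6 / (31/20 - u) ^ 4 - (6 * (s u)\<^sup>2 + 6 * u)" for u
  have "d t > 0 \<and> d' t \<ge> 0"
  proof (rule second_order_positive[where d = d and d' = d' and d'' = d'' and T = T])
    fix u assume u: "0 \<le> u" "u < T"
    define w where "w = 31/20 - u"
    have w: "0 < w" "31/20 - u = w" using u T by (auto simp: w_def)
    show "(d has_real_derivative d' u) (at u)"
      unfolding d_def[abs_def] d'_def
      using DERIV_diff[OF DERIV_diff[OF DERIV_divide_power_diff[of "31/20" u 1 2] DERIV_const] ds[OF u]] w
      by simp
    show "(d' has_real_derivative d'' u) (at u)"
      unfolding d'_def[abs_def] d''_def
      using DERIV_diff[OF DERIV_divide_power_diff[of "31/20" u 2 3] dds[OF u]] w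
      by simp
    assume "d u > 0"
    then have "s u \<le> 1 / w\<^sup>2 - 41/100" by (simp add: d_def w)
    then have "(s u)\<^sup>2 \<le> (1 / w\<^sup>2 - 41/100)\<^sup>2" using s[OF u] by (intro power_mono)
    then show "d'' u \<ge> 0"
      using supersolution_ineq[OF w(1)] by (simp add: d''_def w(2)) (simp add: w_def)
  qed (use t in \<open>auto simp: d_def d'_def init field_simps power2_eq_square\<close>)
  then show "s t \<le> 1 / (31/20 - t)\<^sup>2" "deriv s t \<le> 2 / (31/20 - t) ^ 3"
    by (auto simp: d_def d'_def)
qed

lemma blowup_time_ge:
  assumes max: "maximal_ivp_solution s I" and blow: "is_blowup_time I T"
  shows "T \<ge> 31/20"
proof (rule ccontr)
  assume "\<not> T \<ge> 31/20"
  then have T: "T < 31/20" by simp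
  have sol: "solves_ivp_on s I" using max by (simp add: maximal_ivp_solution_def)
  have T0: "0 < T" and "I \<inter> {0..} = {0..<T}" using blow by (auto simp: is_blowup_time_def)
  then have sub: "{0..<T} \<subseteq> I" by blast
  have ds: "(s has_real_derivative deriv s u) (at u)"
    and dds: "(deriv s has_real_derivative 6 * (s u)\<^sup>2 + 6 * u) (at u)"
    if "0 \<le> u" "u < T" for u
    using sol sub that by (auto simp: solves_ivp_on_def)
  note bounds = solution_bounds[OF sol sub T]
  obtain a where "(s \<longlongrightarrow> a) (at_left T)"
  proof (rule mono_bounded_tendsto_at_left[OF T0])
    show "s x \<le> s y" if "0 \<le> x" "x \<le> y" "y < T" for x y
      by (rule DERIV_nonneg_imp_mono_Ico[OF ds bounds(1)]) (use that in auto)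
    \<comment> \<open>The pointwise bounds grow with \<open>x\<close> and remain finite at
      \<open>T\<close>, since \<open>T < 31/20\<close>; their values at \<open>T\<close> bound
      \<open>s\<close> and \<open>deriv s\<close> uniformly.\<close>
    show "s x \<le> 1 / (31/20 - T)\<^sup>2" if "0 \<le> x" "x < T" for x
      by (rule order_trans[OF bounds(2)[OF that]])
         (use that T in \<open>auto intro!: divide_left_mono power_mono\<close>)
  qed
  moreover obtain b where "(deriv s \<longlongrightarrow> b) (at_left T)"
  proof (rule mono_bounded_tendsto_at_left[OF T0])
    show "deriv s x \<le> deriv s y" if "0 \<le> x" "x \<le> y" "y < T" for x y
      by (rule DERIV_nonneg_imp_mono_Ico[OF dds]) (use that in auto)
    show "deriv s x \<le> 2 / (31/20 - T) ^ 3" if "0 \<le> x" "x < T" for x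
      by (rule order_trans[OF bounds(3)[OF that]])
         (use that T in \<open>auto intro!: divide_left_mono power_mono\<close>)
  qed
  ultimately show False using finite_limits_imp_not_maximal[OF sol blow] max by blast
qed

section \<open>Numerical estimate\<close>

text \<open>The difference of the two sides vanishes at 0 and has derivative
  \<open>y ^ 6 / (1 + y^2)\<close>.\<close>

lemma arctan_le_quintic:
  fixes x :: real
  assumes "0 \<le> x"
  shows "arctan x \<le> x - x ^ 3 / 3 + x ^ 5 / 5"
proof -
  define f where "f y = y - y ^ 3 / 3 + y ^ 5 / 5 - arctan y" for y :: real
  have "f 0 \<le> f x"
  proof (rule DERIV_nonneg_imp_nondecreasing[OF assms])
    fix y :: real
    have "(f has_real_derivative 1 - y\<^sup>2 + y ^ 4 - inverse (1 + y\<^sup>2)) (at y)"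
      unfolding f_def[abs_def]
      by (auto intro!: derivative_eq_intros)
    moreover have "0 \<le> 1 - y\<^sup>2 + y ^ 4 - inverse (1 + y\<^sup>2)"
    proof -
      have p: "0 < 1 + y\<^sup>2" by (simp add: add_pos_nonneg)
      have "(1 - y\<^sup>2 + y ^ 4) * (1 + y\<^sup>2) = 1 + y ^ 6" by algebra
      then have "1 - y\<^sup>2 + y ^ 4 - inverse (1 + y\<^sup>2) = y ^ 6 / (1 + y\<^sup>2)"
        using p by (simp add: field_simps)
      then show ?thesis using p by simp
    qed
    ultimately show "\<exists>D. (f has_real_derivative D) (at y) \<and> 0 \<le> D" by blast
  qed
  then show ?thesis by (simp add: f_def)
qed

text \<open>Since \<open>sqrt (3 / 2)\<close> is the reciprocal of \<open>?x\<close> and the square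
  of \<open>?x\<close> is \<open>2/3\<close>, the quintic bound gives
  \<open>1 - 2/9 + 4/45 = 13/15\<close> for the first term. With \<open>ln (5 / 2) \<le> 1\<close>
  the total is at most \<open>23/15 < 31/20\<close>.\<close>

lemma claimed_bound_less:
  "sqrt (3 / 2) * arctan (sqrt (2 / 3)) + 2 / 3 * ln (5 / 2) < 31/20"
proof -
  let ?x = "sqrt (2 / 3)"
  have inv: "sqrt (3 / 2) * ?x = 1" by (simp flip: real_sqrt_mult)
  have p3: "?x ^ 3 = ?x * (2/3)" and p5: "?x ^ 5 = ?x * (4/9)"
    by (simp_all add: eval_nat_numeral flip: real_sqrt_mult)
  have "sqrt (3 / 2) * arctan ?x \<le> sqrt (3 / 2) * (?x - ?x ^ 3 / 3 + ?x ^ 5 / 5)"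
    by (intro mult_left_mono arctan_le_quintic) auto
  also have "\<dots> = (sqrt (3 / 2) * ?x) * (13/15)"
    unfolding p3 p5 by (simp add: algebra_simps)
  finally have "sqrt (3 / 2) * arctan ?x \<le> 13/15" by (simp add: inv)
  moreover have "ln (5 / 2) \<le> (1::real)"
  proof -
    \<comment> \<open>The quadratic Taylor polynomial of \<open>exp\<close> at 1 is exactly
      \<open>1 + 1 + 1/2 = 5/2\<close>.\<close>
    have "5 / 2 \<le> exp (1::real)"
      using exp_lower_Taylor_quadratic[of 1] by simp
    then show ?thesis using ln_le_cancel_iff[of "5/2" "exp 1"] by simp
  qed
  ultimately show ?thesis by linarith
qed

theorem theorem2:
  fixes s :: "real \<Rightarrow> real" and I :: "real set" and t_inf :: real
  assumes "maximal_ivp_solution s I"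
    and "is_blowup_time I t_inf"
  shows "t_inf > sqrt (3 / 2) * arctan (sqrt (2 / 3)) + 2 / 3 * ln (5 / 2)"
  using claimed_bound_less blowup_time_ge[OF assms] by linarith

end
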